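(* Let $\mathcal{D}$ be a non-empty set of bounded random variables and let $\underline{P}:\mathcal{D}\to\mathbb{R}$ be bi-coherent. (a) If $X,\,Y,\,X+Y\in\mathcal{D}$, then $\underline{P}(X+Y)=\underline{P}(X)+\underline{P}(Y)$. (b) If $X,\,\alpha X\in\mathcal{D}$ with $\alpha\in\mathbb{R}$, then $\underline{P}(\alpha X)=\alpha\underline{P}(X)$.
   Context: Bounded random variables are bounded real-valued functions on a common non-empty set of atoms; $\sup$ is the supremum over all atoms. A map $\underline{P}:\mathcal{D}\to\mathbb{R}$ is a bi-coherent lower prevision on $\mathcal{D}$ iff for all integers $n\ge 0$, all $X_1,\dots,X_n,Y_1,Y_2\in\mathcal{D}$ and all real $s_1,\dots,s_n,r_1,r_2\ge 0$, putting $$G=\sum_{i=1}^n s_i\bigl(X_i-\underline{P}(X_i)\bigr)-r_1\bigl(Y_1-\underline{P}(Y_1)\bigr)-r_2\bigl(Y_2-\underline{P}(Y_2)\bigr),$$ one has $\sup G\ge 0$. *)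

theory Defs
  imports "HOL-Analysis.Analysis"
begin

(* The atoms are the elements of the type 'a, which is non-empty like every HOL type. *)

type_synonym 'a rv = "'a \<Rightarrow> real"

definition bounded_rv :: "'a rv \<Rightarrow> bool" where
  "bounded_rv X \<longleftrightarrow> bounded (range X)"

definition bi_gain ::
  "('a rv \<Rightarrow> real) \<Rightarrow> nat \<Rightarrow> (nat \<Rightarrow> real) \<Rightarrow> (nat \<Rightarrow> 'a rv) \<Rightarrow>
    real \<Rightarrow> 'a rv \<Rightarrow> real \<Rightarrow> 'a rv \<Rightarrow> 'a rv" where
  "bi_gain P n s X r1 Y1 r2 Y2 = (\<lambda>\<omega>.
     (\<Sum>i = 1..n. s i * (X i \<omega> - P (X i))) - r1 * (Y1 \<omega> - P Y1) - r2 * (Y2 \<omega> - P Y2))"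

(* A prevision on D is a total function of which only the values on D are used.
   The real-valued supremum is meaningful only when D consists of bounded random
   variables, in which case every gain is bounded. *)

definition bi_coherent :: "'a rv set \<Rightarrow> ('a rv \<Rightarrow> real) \<Rightarrow> bool" where
  "bi_coherent D P \<longleftrightarrow>
     (\<forall>n s X r1 Y1 r2 Y2.
        (\<forall>i\<in>{1..n}. X i \<in> D \<and> 0 \<le> s i) \<and> Y1 \<in> D \<and> Y2 \<in> D \<and> 0 \<le> r1 \<and> 0 \<le> r2 \<longrightarrow>
        0 \<le> (SUP \<omega>. bi_gain P n s X r1 Y1 r2 Y2 \<omega>))"

end

theory Submission
  imports Defs
begin

text \<open>
  If the random variables entering a gain satisfy a linear relation, their values cancel
  and the gain is a constant built from the previsions alone. Its supremum is that constant, so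
  bi-coherence makes the constant non-negative. A relation
  \<open>s\<^sub>1 X\<^sub>1 + s\<^sub>2 X\<^sub>2 = r\<^sub>1 Y\<^sub>1 + r\<^sub>2 Y\<^sub>2\<close> with non-negative coefficients has at most two terms on
  either side, so each side can play the role of the two short bets: reading it in both
  directions gives two opposite inequalities, hence the same relation between the previsions
  (lemma \<open>bi_coherent_two_term_eq\<close>). Additivity and homogeneity are both
  relations of this kind; for a negative factor \<open>\<alpha>\<close> one writes
  \<open>(-\<alpha>) X + \<alpha> X = 0\<close> to keep the coefficients non-negative.
\<close>

lemma bi_coherent_two_term_le:
  fixes D :: "'a rv set"
  assumes "bi_coherent D P"
    and D: "X1 \<in> D" "X2 \<in> D" "Y1 \<in> D" "Y2 \<in> D"
    and nonneg: "0 \<le> s1" "0 \<le> s2" "0 \<le> r1" "0 \<le> r2"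
    and rel: "\<And>\<omega>. s1 * X1 \<omega> + s2 * X2 \<omega> = r1 * Y1 \<omega> + r2 * Y2 \<omega>"
  shows "s1 * P X1 + s2 * P X2 \<le> r1 * P Y1 + r2 * P Y2"
proof -
  define s where "s i = (if i = 1 then s1 else s2)" for i :: nat
  define X where "X i = (if i = 1 then X1 else X2)" for i :: nat
  have "bi_gain P 2 s X r1 Y1 r2 Y2 \<omega>
      = r1 * P Y1 + r2 * P Y2 - (s1 * P X1 + s2 * P X2)" for \<omega>
    using rel[of \<omega>] by (simp add: bi_gain_def s_def X_def numeral_2_eq_2 algebra_simps)
  moreover have "0 \<le> (SUP \<omega>. bi_gain P 2 s X r1 Y1 r2 Y2 \<omega>)"
    using assms(1) D nonneg unfolding bi_coherent_def by (simp add: s_def X_def)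
  ultimately show ?thesis by simp
qed

text \<open>
  The hypotheses of the inequality above are symmetric in the two sides of the relation, so it
  applies in both directions.
\<close>

lemma bi_coherent_two_term_eq:
  fixes D :: "'a rv set"
  assumes "bi_coherent D P"
    and "X1 \<in> D" "X2 \<in> D" "Y1 \<in> D" "Y2 \<in> D"
    and "0 \<le> s1" "0 \<le> s2" "0 \<le> r1" "0 \<le> r2"
    and rel: "\<And>\<omega>. s1 * X1 \<omega> + s2 * X2 \<omega> = r1 * Y1 \<omega> + r2 * Y2 \<omega>"
  shows "s1 * P X1 + s2 * P X2 = r1 * P Y1 + r2 * P Y2"
  using bi_coherent_two_term_le[OF assms]
    bi_coherent_two_term_le[OF assms(1,4,5,2,3,8,9,6,7) rel[symmetric]]
  by (rule antisym)

theorem proposition6: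
  fixes D :: "('a \<Rightarrow> real) set" and P :: "('a \<Rightarrow> real) \<Rightarrow> real"
  assumes "D \<noteq> {}"
    and "\<forall>X\<in>D. bounded_rv X"
    and "bi_coherent D P"
  shows "(\<forall>X Y. X \<in> D \<and> Y \<in> D \<and> (\<lambda>\<omega>. X \<omega> + Y \<omega>) \<in> D \<longrightarrow>
           P (\<lambda>\<omega>. X \<omega> + Y \<omega>) = P X + P Y) \<and>
         (\<forall>X (\<alpha>::real). X \<in> D \<and> (\<lambda>\<omega>. \<alpha> * X \<omega>) \<in> D \<longrightarrow>
           P (\<lambda>\<omega>. \<alpha> * X \<omega>) = \<alpha> * P X)"
proof (intro conjI allI impI; elim conjE)
  fix X Y
  assume D: "X \<in> D" "Y \<in> D" "(\<lambda>\<omega>. X \<omega> + Y \<omega>) \<in> D"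
  show "P (\<lambda>\<omega>. X \<omega> + Y \<omega>) = P X + P Y"
    using bi_coherent_two_term_eq[OF assms(3) D(1,2,3,1), of 1 1 1 0] by simp
next
  fix X and \<alpha> :: real
  assume D: "X \<in> D" "(\<lambda>\<omega>. \<alpha> * X \<omega>) \<in> D"
  show "P (\<lambda>\<omega>. \<alpha> * X \<omega>) = \<alpha> * P X"
  proof (cases "0 \<le> \<alpha>")
    case True
    then show ?thesis
      using bi_coherent_two_term_eq[OF assms(3) D(1,1,2,1), of \<alpha> 0 1 0] by simp
  next
    case False
    then show ?thesis
      using bi_coherent_two_term_eq[OF assms(3) D(1,2,1,1), of "- \<alpha>" 1 0 0] by simp
  qed
qed

end
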